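(* Let $n,m\ge 0$ be integers and $0\le a\le 1$. Let $Z_n,Z_m$ be independent inverse Gamma random variables with distributions $\tilde\gamma_{n+\frac12}$ and $\tilde\gamma_{m+\frac12}$ respectively. Then the distribution of $a^2Z_n+(1-a)^2Z_m$ has a density which is a convex combination of inverse Gamma densities.
   Context: For $\nu>0$, $\tilde\gamma_\nu$ denotes the inverse Gamma distribution with scale parameter $\frac14$ and shape parameter $\nu$, i.e. the probability measure on $(0,\infty)$ with density $$C_\nu\exp\!\left(-\frac1{4t}\right)t^{-\nu-1},\qquad C_\nu=\frac{1}{2^{2\nu}\Gamma(\nu)}.$$ Even when $n=m$, $Z_n$ and $Z_m$ denote two independent random variables. *)

theory Defs
  imports "HOL-Probability.Probability"
begin

text \<open>The inverse Gamma density with scale parameter 1/4 and shape parameter \<open>\<nu>\<close>,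
  extended by 0 to the real line.\<close>

definition inv_gamma_density :: "real \<Rightarrow> real \<Rightarrow> real" where
  "inv_gamma_density \<nu> t =
     (if t > 0 then 1 / (2 powr (2 * \<nu>) * Gamma \<nu>) * exp (- 1 / (4 * t)) * t powr (- \<nu> - 1)
      else 0)"

definition inv_gamma_convex_combination :: "(real \<Rightarrow> real) \<Rightarrow> bool" where
  "inv_gamma_convex_combination f \<longleftrightarrow>
     (\<exists>S w. finite S \<and> (\<forall>\<nu>\<in>S. \<nu> > 0 \<and> w \<nu> \<ge> 0) \<and> (\<Sum>\<nu>\<in>S. w \<nu>) = 1 \<and>
            f = (\<lambda>t. \<Sum>\<nu>\<in>S. w \<nu> * inv_gamma_density \<nu> t))"

end

theory Submission
  imports Defs "HOL-Real_Asymp.Real_Asymp" "HOL-Computational_Algebra.Polynomial"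
begin

text \<open>
  For \<open>0 < a < 1\<close> and \<open>b = 1 - a\<close>, substituting \<open>r = y / (t - y)\<close> in the convolution of the
  two scaled densities at \<open>t\<close> yields a constant times
  \<open>t^(-n-m-2) exp (-(a^2 + b^2)/(4t))\<close> times the integral of
  \<open>(1+r)^(n+m+1) r^(-m-3/2) exp (-(a^2 r + b^2/r)/(4t))\<close> over \<open>r > 0\<close>.
  Expanding the binomial leaves Bessel integrals with half-integer exponents. They are elementary:
  by the three-term recursion with nonnegative coefficients, each of them is
  \<open>sqrt t exp (-ab/(2t))\<close> times a polynomial in \<open>t\<close> with nonnegative coefficients, and the
  symmetry \<open>r \<mapsto> 1/r\<close>, which handles the negative exponents, keeps the degrees at most \<open>n + m\<close>,
  so that only positive shape parameters occur. Since \<open>a + b = 1\<close>, the exponentials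
  combine to \<open>exp (-1/(4t))\<close>, so the convolution is a nonnegative combination of inverse Gamma
  densities; the weights add up to 1 because everything has total mass 1.
\<close>

section \<open>Improper integrals through primitives\<close>

text \<open>
  An explicit primitive gives both the existence and the value of each improper integral, and
  primitives are stable under linear combination and substitution, so measure theory enters only
  in the final convolution. \<open>F\<close> and \<open>G\<close> are the filters approaching the two ends of \<open>S\<close>.
\<close>

definition has_newton_integral ::
    "(real \<Rightarrow> real) \<Rightarrow> real \<Rightarrow> real set \<Rightarrow> real filter \<Rightarrow> real filter \<Rightarrow> bool" where
  "has_newton_integral f V S F G \<longleftrightarrow>
     (\<exists>P l u. (\<forall>x\<in>S. (P has_real_derivative f x) (at x)) \<and>
              (P \<longlongrightarrow> l) F \<and> (P \<longlongrightarrow> u) G \<and> V = u - l)"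

lemma has_newton_integralI:
  assumes "\<And>x. x \<in> S \<Longrightarrow> (P has_real_derivative f x) (at x)"
    and "(P \<longlongrightarrow> l) F" and "(P \<longlongrightarrow> u) G" and "V = u - l"
  shows "has_newton_integral f V S F G"
  using assms unfolding has_newton_integral_def by blast

lemma has_newton_integral_cong:
  assumes "\<And>x. x \<in> S \<Longrightarrow> f x = g x" and "has_newton_integral f V S F G"
  shows "has_newton_integral g V S F G"
  using assms unfolding has_newton_integral_def by metis

lemma has_newton_integral_add:
  assumes "has_newton_integral f V S F G" and "has_newton_integral g W S F G"
  shows "has_newton_integral (\<lambda>x. f x + g x) (V + W) S F G"
proof -
  obtain P l u where P: "\<And>x. x \<in> S \<Longrightarrow> (P has_real_derivative f x) (at x)"
      "(P \<longlongrightarrow> l) F" "(P \<longlongrightarrow> u) G" "V = u - l"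
    using assms(1) unfolding has_newton_integral_def by blast
  obtain Q l' u' where Q: "\<And>x. x \<in> S \<Longrightarrow> (Q has_real_derivative g x) (at x)"
      "(Q \<longlongrightarrow> l') F" "(Q \<longlongrightarrow> u') G" "W = u' - l'"
    using assms(2) unfolding has_newton_integral_def by blast
  show ?thesis
    by (rule has_newton_integralI[where P = "\<lambda>x. P x + Q x" and l = "l + l'" and u = "u + u'"])
       (auto intro!: DERIV_add tendsto_add P Q simp: P Q)
qed

lemma has_newton_integral_cmult:
  assumes "has_newton_integral f V S F G"
  shows "has_newton_integral (\<lambda>x. c * f x) (c * V) S F G"
proof -
  obtain P l u where P: "\<And>x. x \<in> S \<Longrightarrow> (P has_real_derivative f x) (at x)"
      "(P \<longlongrightarrow> l) F" "(P \<longlongrightarrow> u) G" "V = u - l"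
    using assms(1) unfolding has_newton_integral_def by blast
  show ?thesis
    by (rule has_newton_integralI[where P = "\<lambda>x. c * P x" and l = "c * l" and u = "c * u"])
       (auto intro!: DERIV_cmult tendsto_mult_left P simp: P algebra_simps)
qed

lemma has_newton_integral_sum:
  assumes "finite I" and "\<And>i. i \<in> I \<Longrightarrow> has_newton_integral (f i) (V i) S F G"
  shows "has_newton_integral (\<lambda>x. \<Sum>i\<in>I. f i x) (\<Sum>i\<in>I. V i) S F G"
  using assms
proof (induction I rule: finite_induct)
  case empty
  show ?case
    by (rule has_newton_integralI[where P = "\<lambda>_. 0" and l = 0 and u = 0]) auto
qed (auto intro: has_newton_integral_add)

lemma has_newton_integral_substitution:
  assumes "has_newton_integral f V S F G"
    and "\<And>x. x \<in> T \<Longrightarrow> g x \<in> S"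
    and "\<And>x. x \<in> T \<Longrightarrow> (g has_real_derivative g' x) (at x)"
    and "filterlim g F F'" and "filterlim g G G'"
  shows "has_newton_integral (\<lambda>x. f (g x) * g' x) V T F' G'"
proof -
  obtain P l u where P: "\<And>x. x \<in> S \<Longrightarrow> (P has_real_derivative f x) (at x)"
      "(P \<longlongrightarrow> l) F" "(P \<longlongrightarrow> u) G" "V = u - l"
    using assms(1) unfolding has_newton_integral_def by blast
  show ?thesis
    by (rule has_newton_integralI[where P = "\<lambda>x. P (g x)" and l = l and u = u])
       (auto intro: DERIV_chain2 P assms filterlim_compose[OF P(2) assms(4)]
          filterlim_compose[OF P(3) assms(5)])
qed

text \<open>The passage to Lebesgue integrals: for a nonnegative continuous integrand, the limits of
  a primitive at both ends yield integrability as well as the value. The equations for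
  \<open>F\<close> and \<open>G\<close> turn one-sided extended-real filters into real ones, so
  finite and infinite endpoints are covered at once.\<close>

lemma nn_integral_has_newton_integral:
  fixes a b :: ereal
  assumes newton: "has_newton_integral f V (einterval a b) F G" and "a < b"
    and FG: "at_right a = filtermap ereal F" "at_left b = filtermap ereal G"
    and cont: "\<And>x. x \<in> einterval a b \<Longrightarrow> isCont f x"
    and nonneg: "\<And>x. x \<in> einterval a b \<Longrightarrow> 0 \<le> f x"
  shows "(\<integral>\<^sup>+x. ennreal (f x) * indicator (einterval a b) x \<partial>lborel) = ennreal V"
proof -
  obtain P l u where P: "\<And>x. x \<in> einterval a b \<Longrightarrow> (P has_real_derivative f x) (at x)"
      "(P \<longlongrightarrow> l) F" "(P \<longlongrightarrow> u) G" "V = u - l"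
    using newton unfolding has_newton_integral_def by blast
  have lim: "((P \<circ> real_of_ereal) \<longlongrightarrow> l) (at_right a)"
    "((P \<circ> real_of_ereal) \<longlongrightarrow> u) (at_left b)"
    using P by (simp_all add: FG filterlim_filtermap comp_def)
  have int: "set_integrable lborel (einterval a b) f"
    and val: "(LBINT x=a..b. f x) = u - l"
    by (rule interval_integral_FTC_nonneg[OF _ _ _ _ lim];
        use \<open>a < b\<close> P(1) cont nonneg in \<open>auto simp: einterval_def\<close>)+
  have int': "integrable lborel (\<lambda>x. f x * indicator (einterval a b) x)"
    using int by (simp add: set_integrable_def mult.commute)
  have "(\<integral>\<^sup>+x. ennreal (f x) * indicator (einterval a b) x \<partial>lborel)
      = (\<integral>\<^sup>+x. ennreal (f x * indicator (einterval a b) x) \<partial>lborel)"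
    by (intro nn_integral_cong) (auto split: split_indicator)
  also have "\<dots> = ennreal (\<integral>x. f x * indicator (einterval a b) x \<partial>lborel)"
    by (rule nn_integral_eq_integral[OF int']) (auto split: split_indicator intro!: AE_I2 nonneg)
  also have "(\<integral>x. f x * indicator (einterval a b) x \<partial>lborel) = V"
    using val \<open>a < b\<close> P(4)
    by (simp add: interval_lebesgue_integral_def less_imp_le set_lebesgue_integral_def mult.commute)
  finally show ?thesis .
qed

section \<open>The Gauss integral\<close>

text \<open>A multiple of a normal distribution function is such a primitive. The limits 0 and
  \<open>sqrt pi\<close> are then the limits 0 and 1 of a distribution function, rescaled.\<close>

lemma gaussian_primitive:
  obtains \<Psi> :: "real \<Rightarrow> real" where
    "\<And>x. (\<Psi> has_real_derivative exp (- x\<^sup>2)) (at x)"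
    "(\<Psi> \<longlongrightarrow> 0) at_bot" "(\<Psi> \<longlongrightarrow> sqrt pi) at_top"
proof -
  \<comment> \<open>With variance 1/2 the normal density is
    \<open>exp (- x^2) / sqrt pi\<close>.\<close>
  define g where "g = normal_density 0 (1 / sqrt 2)"
  define M where "M = density lborel (\<lambda>x. ennreal (g x))"
  have g: "sqrt pi * g x = exp (- x\<^sup>2)" for x
    by (simp add: g_def normal_density_def power_divide)
  have int: "integrable lborel g"
    unfolding g_def by simp
  have [measurable]: "g \<in> borel_measurable borel"
    unfolding g_def by simp
  have g_nonneg: "0 \<le> g x" for x
    unfolding g_def by simp
  have cont_g: "continuous_on S g" for S
    by (auto simp: g_def normal_density_def intro!: continuous_intros)
  have "prob_space M"
    unfolding M_def g_def by (intro prob_space_normal_density) simp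
  then interpret real_distribution M
    by (simp add: real_distribution_def real_distribution_axioms_def M_def)
  have cdf_eq: "cdf M y = cdf M a + integral {a..y} g" if "a < y" for a y
  proof -
    \<comment> \<open>Increments of \<open>cdf\<close> live on half-open intervals,
      Henstock-Kurzweil integrals on closed ones; the point \<open>a\<close> is a null set.\<close>
    have ae: "AE x in lborel. x \<noteq> a"
      by (rule AE_lborel_singleton)
    have "emeasure M {a<..y} = (\<integral>\<^sup>+x. ennreal (g x) * indicator {a<..y} x \<partial>lborel)"
      unfolding M_def by (rule emeasure_density) auto
    also have "\<dots> = (\<integral>\<^sup>+x. ennreal (indicator {a..y} x * g x) \<partial>lborel)"
      by (rule nn_integral_cong_AE, use ae in eventually_elim) (auto split: split_indicator)
    also have "\<dots> = ennreal (\<integral>x. indicator {a..y} x * g x \<partial>lborel)"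
      using int by (intro nn_integral_eq_integral)
        (auto simp: g_nonneg integrable_mult_indicator[of "{a..y}" lborel g, simplified])
    also have "(\<integral>x. indicator {a..y} x * g x \<partial>lborel) = integral {a..y} g"
      using set_borel_integral_eq_integral(2)[of "{a..y}" g] int
      by (simp add: set_lebesgue_integral_def set_integrable_def
          integrable_mult_indicator[of "{a..y}" lborel g, simplified])
    finally have "measure M {a<..y} = integral {a..y} g"
      by (simp add: measure_def Henstock_Kurzweil_Integration.integral_nonneg
          integrable_continuous_real g_nonneg cont_g)
    then show ?thesis
      using cdf_diff_eq[OF that] by simp
  qed
  have der: "(cdf M has_real_derivative g x) (at x)" for x
  proof -
    \<comment> \<open>Starting the integral at \<open>x - 1\<close> makes \<open>x\<close> an
      interior point, so the derivative within the interval is a full derivative.\<close>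
    have "at x within {x - 1..x + 1} = at x"
      by (rule at_within_Icc_at) auto
    then have "((\<lambda>y. integral {x - 1..y} g) has_real_derivative g x) (at x)"
      using integral_has_real_derivative[OF cont_g, of x "x - 1" "x + 1"] by simp
    then have "((\<lambda>y. cdf M (x - 1) + integral {x - 1..y} g) has_real_derivative g x) (at x)"
      by (auto intro!: derivative_eq_intros)
    then show ?thesis
      by (rule has_field_derivative_transform_within_open[where S = "{x - 1<..}"])
         (auto simp: cdf_eq)
  qed
  show ?thesis
  proof (rule that[of "\<lambda>x. sqrt pi * cdf M x"])
    show "((\<lambda>x. sqrt pi * cdf M x) has_real_derivative exp (- x\<^sup>2)) (at x)" for x
      using DERIV_cmult[OF der, of "sqrt pi" x] by (simp add: g)
    show "((\<lambda>x. sqrt pi * cdf M x) \<longlongrightarrow> 0) at_bot"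
      using tendsto_mult_left[OF cdf_lim_at_bot, of "sqrt pi"] by simp
    show "((\<lambda>x. sqrt pi * cdf M x) \<longlongrightarrow> sqrt pi) at_top"
      using tendsto_mult_left[OF cdf_lim_at_top_prob, of "sqrt pi"] by simp
  qed
qed

section \<open>Bessel integrals with half-integer exponents\<close>

text \<open>These are the boundary terms in the integration by parts behind the recursion.\<close>

lemma powr_exp_limits:
  fixes A B s :: real
  assumes "A > 0" "B > 0"
  shows "((\<lambda>r. r powr s * exp (- (A * r + B / r))) \<longlongrightarrow> 0) (at_right 0)"
    and "((\<lambda>r. r powr s * exp (- (A * r + B / r))) \<longlongrightarrow> 0) at_top"
  using assms by real_asymp+

text \<open>For positive \<open>A\<close> and \<open>B\<close> the value \<open>V\<close> is
  \<open>2 (B/A)^((s+1)/2) K_(s+1)(2 sqrt (A B))\<close>, with \<open>K\<close> the modified Bessel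
  function of the second kind. Half-integer \<open>s\<close> gives half-integer orders, where
  \<open>K\<close> is elementary.\<close>

abbreviation bessel_integral :: "real \<Rightarrow> real \<Rightarrow> real \<Rightarrow> real \<Rightarrow> bool" where
  "bessel_integral A B s V \<equiv>
    has_newton_integral (\<lambda>r. r powr s * exp (- (A * r + B / r))) V {0<..} (at_right 0) at_top"

text \<open>The derivative of \<open>r powr (s + 1) * exp (- (A * r + B / r))\<close> is a
  combination of the three integrands and has integral 0. The coefficients obtained are nonnegative
  as soon as \<open>s \<ge> -1\<close>.\<close>

lemma bessel_integral_recursion:
  assumes "A > 0" "B > 0" "bessel_integral A B (s - 1) V" "bessel_integral A B s W"
  shows "bessel_integral A B (s + 1) ((s + 1) / A * W + B / A * V)"
proof -
  let ?E = "\<lambda>r. exp (- (A * r + B / r))"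
  have "has_newton_integral (\<lambda>r. (s + 1) * (r powr s * ?E r) - A * (r powr (s + 1) * ?E r)
      + B * (r powr (s - 1) * ?E r)) 0 {0<..} (at_right 0) at_top"
  proof (rule has_newton_integralI)
    show "((\<lambda>r. r powr (s + 1) * ?E r) \<longlongrightarrow> 0) (at_right 0)"
      "((\<lambda>r. r powr (s + 1) * ?E r) \<longlongrightarrow> 0) at_top"
      using powr_exp_limits assms by auto
    fix r :: real assume "r \<in> {0<..}"
    then have "r > 0" by simp
    have pow: "((\<lambda>r. r powr (s + 1)) has_real_derivative (s + 1) * r powr s) (at r)"
      using has_real_derivative_powr[OF \<open>r > 0\<close>, of "s + 1"] by simp
    have "((\<lambda>r. - (A * r + B / r)) has_real_derivative B / r\<^sup>2 - A) (at r)"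
      using \<open>r > 0\<close> by (auto intro!: derivative_eq_intros simp: field_simps power2_eq_square)
    from DERIV_mult[OF pow DERIV_chain2[OF DERIV_exp this]]
    show "((\<lambda>r. r powr (s + 1) * ?E r) has_real_derivative
       (s + 1) * (r powr s * ?E r) - A * (r powr (s + 1) * ?E r) + B * (r powr (s - 1) * ?E r)) (at r)"
      by (rule back_subst) (use \<open>r > 0\<close> in
          \<open>simp add: algebra_simps powr_add powr_diff power2_eq_square\<close>)
  qed auto
  \<comment> \<open>Scaling the vanishing integral by \<open>- (1 / A)\<close> and adding the two
    known integrals leaves only the integrand with exponent \<open>s + 1\<close>.\<close>
  from has_newton_integral_add[OF has_newton_integral_cmult[OF this, of "- (1 / A)"]
      has_newton_integral_add[OF has_newton_integral_cmult[OF assms(4), of "(s + 1) / A"]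
        has_newton_integral_cmult[OF assms(3), of "B / A"]]]
  have "has_newton_integral (\<lambda>r. - (1 / A) * ((s + 1) * (r powr s * ?E r) - A * (r powr (s + 1) * ?E r)
        + B * (r powr (s - 1) * ?E r))
      + ((s + 1) / A * (r powr s * ?E r) + B / A * (r powr (s - 1) * ?E r)))
      ((s + 1) / A * W + B / A * V) {0<..} (at_right 0) at_top"
    by simp
  then show ?thesis
    by (rule has_newton_integral_cong[rotated])
       (use \<open>A > 0\<close> in \<open>simp add: right_diff_distrib distrib_left\<close>)
qed

text \<open>Substitution of \<open>1 / r\<close>. This map reverses the orientation, hence the minus
  sign in the primitive and the exchanged limits.\<close>

lemma bessel_integral_reflect:
  assumes "bessel_integral A B s V"
  shows "bessel_integral B A (- s - 2) V"
proof -
  obtain P l u where P: "\<And>r. r > 0 \<Longrightarrow> (P has_real_derivative r powr s * exp (- (A * r + B / r))) (at r)"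
      "(P \<longlongrightarrow> l) (at_right 0)" "(P \<longlongrightarrow> u) at_top" "V = u - l"
    using assms unfolding has_newton_integral_def by force
  show ?thesis
  proof (rule has_newton_integralI[where P = "\<lambda>r. - P (1 / r)" and l = "- u" and u = "- l"])
    show "((\<lambda>r. - P (1 / r)) \<longlongrightarrow> - u) (at_right 0)"
      by (intro tendsto_minus filterlim_compose[OF P(3)]) real_asymp
    show "((\<lambda>r. - P (1 / r)) \<longlongrightarrow> - l) at_top"
      by (intro tendsto_minus filterlim_compose[OF P(2)]) real_asymp
    fix r :: real assume "r \<in> {0<..}"
    then show "((\<lambda>r. - P (1 / r)) has_real_derivative r powr (- s - 2) * exp (- (B * r + A / r))) (at r)"
      by (auto intro!: derivative_eq_intros DERIV_chain2[OF P(1)]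
          simp: field_simps powr_diff powr_minus powr_divide power2_eq_square)
  qed (simp add: P)
qed

text \<open>The start of the recursion, of order 1/2: completing the square in two ways reduces it
  to the Gauss integral.\<close>

lemma bessel_integral_half:
  assumes pos: "\<alpha> > 0" "\<beta> > 0"
  shows "bessel_integral (\<alpha>\<^sup>2) (\<beta>\<^sup>2) (- 1 / 2) (sqrt pi / \<alpha> * exp (- 2 * \<alpha> * \<beta>))"
proof -
  obtain \<Psi> where \<Psi>: "\<And>x. (\<Psi> has_real_derivative exp (- x\<^sup>2)) (at x)"
      "(\<Psi> \<longlongrightarrow> 0) at_bot" "(\<Psi> \<longlongrightarrow> sqrt pi) at_top"
    using gaussian_primitive by metis
    define p where "p = (\<lambda>r. \<alpha> * sqrt r + \<beta> / sqrt r)"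
    define q where "q = (\<lambda>r. \<alpha> * sqrt r - \<beta> / sqrt r)"
    \<comment> \<open>\<open>p\<^sup>2 - 2\<alpha>\<beta> = q\<^sup>2 + 2\<alpha>\<beta> = \<alpha>\<^sup>2 r + \<beta>\<^sup>2 / r\<close>, and the \<open>\<beta>\<close>-parts of the derivatives of \<open>p\<close> and \<open>q\<close> cancel.\<close>
    let ?P = "\<lambda>r. 1 / \<alpha> * (exp (2 * \<alpha> * \<beta>) * \<Psi> (p r) + exp (- 2 * \<alpha> * \<beta>) * \<Psi> (q r))"
    show ?thesis
    proof (rule has_newton_integralI)
      \<comment> \<open>Near 0, \<open>p\<close> tends to plus and \<open>q\<close> to minus
        infinity; at infinity both tend to plus infinity. So the \<open>p\<close> terms cancel in
        the difference of the limits and only the factor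
        \<open>exp (- 2 * \<alpha> * \<beta>)\<close> survives.\<close>
      show "(?P \<longlongrightarrow> 1 / \<alpha> * (exp (2 * \<alpha> * \<beta>) * sqrt pi + exp (- 2 * \<alpha> * \<beta>) * 0)) (at_right 0)"
        unfolding p_def q_def using pos
        by (intro tendsto_intros filterlim_compose[OF \<Psi>(2)] filterlim_compose[OF \<Psi>(3)]; real_asymp)
      show "(?P \<longlongrightarrow> 1 / \<alpha> * (exp (2 * \<alpha> * \<beta>) * sqrt pi + exp (- 2 * \<alpha> * \<beta>) * sqrt pi)) at_top"
        unfolding p_def q_def using pos
        by (intro tendsto_intros filterlim_compose[OF \<Psi>(3)]; real_asymp)
      fix r :: real assume r: "r \<in> {0<..}"
      have sq: "sqrt r * sqrt r = r" "r powr (- 1 / 2) = 1 / sqrt r"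
        using r by (auto simp: powr_half_sqrt powr_minus_divide)
      have p': "(p has_real_derivative (\<alpha> - \<beta> / r) / (2 * sqrt r)) (at r)"
        unfolding p_def using r sq
        by (auto intro!: derivative_eq_intros simp: field_simps)
      have q': "(q has_real_derivative (\<alpha> + \<beta> / r) / (2 * sqrt r)) (at r)"
        unfolding q_def using r sq
        by (auto intro!: derivative_eq_intros simp: field_simps)
      have sq2: "exp (2 * \<alpha> * \<beta>) * exp (- (p r)\<^sup>2) = exp (- (\<alpha>\<^sup>2 * r + \<beta>\<^sup>2 / r))"
        "exp (- 2 * \<alpha> * \<beta>) * exp (- (q r)\<^sup>2) = exp (- (\<alpha>\<^sup>2 * r + \<beta>\<^sup>2 / r))"
        using r by (simp_all add: p_def q_def power2_sum power2_diff power_mult_distrib power_divide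
            flip: exp_add)
      have "(?P has_real_derivative 1 / \<alpha> * (exp (2 * \<alpha> * \<beta>) * (exp (- (p r)\<^sup>2) * ((\<alpha> - \<beta> / r) / (2 * sqrt r)))
          + exp (- 2 * \<alpha> * \<beta>) * (exp (- (q r)\<^sup>2) * ((\<alpha> + \<beta> / r) / (2 * sqrt r))))) (at r)"
        by (intro DERIV_cmult DERIV_add DERIV_chain2[OF \<Psi>(1)] p' q')
      also have "1 / \<alpha> * (exp (2 * \<alpha> * \<beta>) * (exp (- (p r)\<^sup>2) * ((\<alpha> - \<beta> / r) / (2 * sqrt r)))
          + exp (- 2 * \<alpha> * \<beta>) * (exp (- (q r)\<^sup>2) * ((\<alpha> + \<beta> / r) / (2 * sqrt r))))
        = r powr (- 1 / 2) * exp (- (\<alpha>\<^sup>2 * r + \<beta>\<^sup>2 / r))"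
        unfolding mult.assoc[symmetric] sq2 sq using pos r by (simp add: field_simps)
      finally show "(?P has_real_derivative r powr (- 1 / 2) * exp (- (\<alpha>\<^sup>2 * r + \<beta>\<^sup>2 / r))) (at r)" .
    qed (simp add: algebra_simps)
qed

text \<open>The recursion has three terms, so the induction carries two consecutive exponents. The
  polynomials are chosen before \<open>t\<close>: one pair serves all \<open>t\<close>.\<close>

lemma bessel_integral_polynomial_nonneg_index:
  fixes a b :: real and p :: nat
  assumes pos: "a > 0" "b > 0"
  shows "\<exists>P Q. degree P \<le> p \<and> degree Q \<le> p \<and> (\<forall>i. 0 \<le> coeff P i) \<and> (\<forall>i. 0 \<le> coeff Q i) \<and>
    (\<forall>t>0. bessel_integral (a\<^sup>2 / (4 * t)) (b\<^sup>2 / (4 * t)) (real p - 3 / 2)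
             (sqrt t * exp (- (a * b) / (2 * t)) * poly P t) \<and>
           bessel_integral (a\<^sup>2 / (4 * t)) (b\<^sup>2 / (4 * t)) (real p - 1 / 2)
             (sqrt t * exp (- (a * b) / (2 * t)) * poly Q t))"
proof (induction p)
  case 0
  \<comment> \<open>The choice \<open>\<alpha> = x / (2 * sqrt t)\<close>,
    \<open>\<beta> = y / (2 * sqrt t)\<close>. It is needed for (\<open>a\<close>, \<open>b\<close>)
    directly and for (\<open>b\<close>, \<open>a\<close>) before reflection, which sends -1/2 to
    -3/2.\<close>
  have half: "bessel_integral (x\<^sup>2 / (4 * t)) (y\<^sup>2 / (4 * t)) (- 1 / 2)
      (sqrt t * exp (- (x * y) / (2 * t)) * (2 * sqrt pi / x))" if "x > 0" "y > 0" "t > 0" for x y t :: real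
  proof -
    have "bessel_integral ((x / (2 * sqrt t))\<^sup>2) ((y / (2 * sqrt t))\<^sup>2) (- 1 / 2)
       (sqrt pi / (x / (2 * sqrt t)) * exp (- 2 * (x / (2 * sqrt t)) * (y / (2 * sqrt t))))"
      using that by (intro bessel_integral_half) auto
    moreover have "- 2 * (x / (2 * sqrt t)) * (y / (2 * sqrt t)) = - (x * y) / (2 * t)"
      using that by (simp add: field_simps)
    moreover have "(z / (2 * sqrt t))\<^sup>2 = z\<^sup>2 / (4 * t)" for z
      using that by (simp add: power_divide power_mult_distrib)
    moreover have "sqrt pi / (x / (2 * sqrt t)) * e = sqrt t * e * (2 * sqrt pi / x)" for e
      by simp
    ultimately show ?thesis
      by (simp only:)
  qed
  have "bessel_integral (a\<^sup>2 / (4 * t)) (b\<^sup>2 / (4 * t)) (- 3 / 2)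
      (sqrt t * exp (- (a * b) / (2 * t)) * (2 * sqrt pi / b))" if "t > 0" for t
    using bessel_integral_reflect[OF half[OF pos(2,1) that]] by (simp add: mult.commute)
  then show ?case
    using half[OF pos]
    by (intro exI[of _ "[:2 * sqrt pi / b:]"] exI[of _ "[:2 * sqrt pi / a:]"])
       (use pos in \<open>auto simp: coeff_pCons split: nat.split\<close>)
next
  case (Suc p)
  then obtain P Q where deg: "degree P \<le> p" "degree Q \<le> p"
    and nonneg: "\<And>i. 0 \<le> coeff P i" "\<And>i. 0 \<le> coeff Q i"
    and P: "\<And>t. t > 0 \<Longrightarrow> bessel_integral (a\<^sup>2 / (4 * t)) (b\<^sup>2 / (4 * t)) (real p - 3 / 2)
             (sqrt t * exp (- (a * b) / (2 * t)) * poly P t)"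
    and Q: "\<And>t. t > 0 \<Longrightarrow> bessel_integral (a\<^sup>2 / (4 * t)) (b\<^sup>2 / (4 * t)) (real p - 1 / 2)
             (sqrt t * exp (- (a * b) / (2 * t)) * poly Q t)"
    by blast
  \<comment> \<open>The recursion at \<open>s = p - 1/2\<close>: \<open>B / A\<close> does not
    depend on \<open>t\<close>, while \<open>1 / A = 4 * t / a^2\<close> contributes one factor
    \<open>t\<close>, the \<open>pCons 0\<close>, which accounts for the growth of the
    degree.\<close>
  define R where "R = smult (b\<^sup>2 / a\<^sup>2) P + pCons 0 (smult (4 * (real p + 1 / 2) / a\<^sup>2) Q)"
  have "degree R \<le> Suc p"
    unfolding R_def using deg by (intro degree_add_le) (auto simp: degree_pCons_eq_if)
  moreover have "0 \<le> coeff R i" for i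
    unfolding R_def using nonneg by (auto simp: coeff_pCons split: nat.split)
  moreover have "bessel_integral (a\<^sup>2 / (4 * t)) (b\<^sup>2 / (4 * t)) (real (Suc p) - 1 / 2)
             (sqrt t * exp (- (a * b) / (2 * t)) * poly R t)" if "t > 0" for t
  proof -
    define A B where "A = a\<^sup>2 / (4 * t)" and "B = b\<^sup>2 / (4 * t)"
    have AB: "A > 0" "B > 0" "1 / A = 4 * t / a\<^sup>2" "B / A = b\<^sup>2 / a\<^sup>2"
      using pos that by (auto simp: A_def B_def)
    have "bessel_integral A B ((real p - 1 / 2) + 1)
        (((real p - 1 / 2) + 1) / A * (sqrt t * exp (- (a * b) / (2 * t)) * poly Q t)
           + B / A * (sqrt t * exp (- (a * b) / (2 * t)) * poly P t))"
      using P[OF that] Q[OF that]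
      by (intro bessel_integral_recursion AB(1,2)) (simp_all add: A_def B_def)
    moreover have "((real p - 1 / 2) + 1) / A = (real p + 1 / 2) * (4 * t / a\<^sup>2)"
      unfolding AB(3)[symmetric] by simp
    moreover have "poly R t = (real p + 1 / 2) * (4 * t / a\<^sup>2) * poly Q t + b\<^sup>2 / a\<^sup>2 * poly P t"
      unfolding R_def by simp
    then have "sqrt t * exp (- (a * b) / (2 * t)) * poly R t
        = (real p + 1 / 2) * (4 * t / a\<^sup>2) * (sqrt t * exp (- (a * b) / (2 * t)) * poly Q t)
           + b\<^sup>2 / a\<^sup>2 * (sqrt t * exp (- (a * b) / (2 * t)) * poly P t)"
      by (simp only: distrib_left mult_ac)
    moreover have "(real p - 1 / 2) + 1 = real (Suc p) - 1 / 2"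
      by simp
    ultimately show ?thesis
      by (simp only: AB(4)[unfolded A_def B_def] A_def B_def)
  qed
  ultimately show ?case
    using deg nonneg Q by (intro exI[of _ Q] exI[of _ R]) auto
qed

text \<open>Exponents with \<open>j > m\<close> are covered by the index
  \<open>p = j - m - 1\<close>, at most \<open>n\<close>. For \<open>j \<le> m\<close>, reflection
  turns the exponent into \<open>(m - j) - 1/2\<close>, the index \<open>p = m - j\<close>, at most
  \<open>m\<close>. Either way the degree stays within \<open>n + m\<close>.\<close>

lemma bessel_integral_polynomial:
  fixes a b :: real and j m n :: nat
  assumes pos: "a > 0" "b > 0" and j: "j \<le> n + m + 1"
  shows "\<exists>P. degree P \<le> n + m \<and> (\<forall>i. 0 \<le> coeff P i) \<and>
    (\<forall>t>0. bessel_integral (a\<^sup>2 / (4 * t)) (b\<^sup>2 / (4 * t)) (real j - real m - 3 / 2)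
       (sqrt t * exp (- (a * b) / (2 * t)) * poly P t))"
proof (cases "j \<le> m")
  case True
  from bessel_integral_polynomial_nonneg_index[OF pos(2,1), of "m - j"]
  obtain P where P: "degree P \<le> m - j" "\<And>i. 0 \<le> coeff P i"
    "\<And>t. t > 0 \<Longrightarrow> bessel_integral (b\<^sup>2 / (4 * t)) (a\<^sup>2 / (4 * t)) (real (m - j) - 1 / 2)
       (sqrt t * exp (- (b * a) / (2 * t)) * poly P t)"
    by blast
  show ?thesis
    using P(1,2) bessel_integral_reflect[OF P(3)] True
    by (intro exI[of _ P]) (simp add: of_nat_diff algebra_simps)
next
  case False
  from bessel_integral_polynomial_nonneg_index[OF pos, of "j - m - 1"]
  obtain P where P: "degree P \<le> j - m - 1" "\<And>i. 0 \<le> coeff P i"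
    "\<And>t. t > 0 \<Longrightarrow> bessel_integral (a\<^sup>2 / (4 * t)) (b\<^sup>2 / (4 * t)) (real (j - m - 1) - 1 / 2)
       (sqrt t * exp (- (a * b) / (2 * t)) * poly P t)"
    by blast
  show ?thesis
    using P False j by (intro exI[of _ P]) (simp add: of_nat_diff algebra_simps)
qed

section \<open>Convolution of the unnormalized densities\<close>

text \<open>The degree bound is what matters: the powers of \<open>t\<close> in the result range
  from \<open>-(n+m) - 3/2\<close> to \<open>-3/2\<close>, those of the shape parameters
  \<open>n + m + 1/2\<close> down to \<open>1/2\<close>.\<close>

lemma inverse_gamma_kernel_convolution:
  fixes a b :: real and m n :: nat
  assumes pos: "a > 0" "b > 0"
  obtains P where "degree P \<le> n + m" "\<And>i. 0 \<le> coeff P i"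
    "\<And>t. t > 0 \<Longrightarrow> has_newton_integral
       (\<lambda>y. ((t - y) powr (- real n - 3 / 2) * exp (- (a\<^sup>2 / (4 * (t - y))))) *
            (y powr (- real m - 3 / 2) * exp (- (b\<^sup>2 / (4 * y)))))
       (t powr (- real (n + m) - 3 / 2) * exp (- ((a + b)\<^sup>2 / (4 * t))) * poly P t)
       {0<..<t} (at_right 0) (at_left t)"
proof -
  \<comment> \<open>With \<open>x = t - y\<close> and \<open>y = r x\<close>, the two powers and
    \<open>dy = x^2 / t dr\<close> leave \<open>x^(-(n+m+1))\<close>, that is
    \<open>((1 + r) / t)^N\<close>; this power of \<open>1 + r\<close> is expanded below.\<close>
  define N where "N = n + m + 1"
  define admissible where "admissible j P \<longleftrightarrow> degree P \<le> n + m \<and> (\<forall>i. 0 \<le> coeff P i) \<and>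
    (\<forall>t>0. bessel_integral (a\<^sup>2 / (4 * t)) (b\<^sup>2 / (4 * t)) (real j - real m - 3 / 2)
       (sqrt t * exp (- (a * b) / (2 * t)) * poly P t))" for j P
  have "\<exists>P. admissible j P" if "j \<le> N" for j
    using bessel_integral_polynomial[OF pos] that unfolding admissible_def N_def by simp
  then obtain P where "\<And>j. j \<le> N \<Longrightarrow> admissible j (P j)"
    by metis
  then have P: "\<And>j. j \<le> N \<Longrightarrow> degree (P j) \<le> n + m"
      "\<And>j i. j \<le> N \<Longrightarrow> 0 \<le> coeff (P j) i"
      "\<And>j t. j \<le> N \<Longrightarrow> t > 0 \<Longrightarrow>
         bessel_integral (a\<^sup>2 / (4 * t)) (b\<^sup>2 / (4 * t)) (real j - real m - 3 / 2)
           (sqrt t * exp (- (a * b) / (2 * t)) * poly (P j) t)"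
    by (simp_all add: admissible_def)
  define R where "R = (\<Sum>j\<le>N. smult (real (N choose j)) (P j))"
  show ?thesis
  proof (rule that[of R])
    show "degree R \<le> n + m"
      unfolding R_def using P(1) by (intro degree_sum_le) auto
    show "0 \<le> coeff R i" for i
      unfolding R_def coeff_sum using P(2) by (intro sum_nonneg) auto
    fix t :: real assume t: "t > 0"
    let ?E = "\<lambda>r. exp (- (a\<^sup>2 / (4 * t) * r + b\<^sup>2 / (4 * t) / r))"
    \<comment> \<open>The factors free of \<open>r\<close>. The exponential arises from
      \<open>a^2/(4x) = a^2/(4t) (1 + r)\<close> and
      \<open>b^2/(4y) = b^2/(4t) (1 + 1/r)\<close>.\<close>
    let ?c = "t powr (- real N - 1) * exp (- ((a\<^sup>2 + b\<^sup>2) / (4 * t)))"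
    have "has_newton_integral (\<lambda>r. ?c * (\<Sum>j\<le>N. real (N choose j) * (r powr (real j - real m - 3 / 2) * ?E r)))
        (?c * (\<Sum>j\<le>N. real (N choose j) * (sqrt t * exp (- (a * b) / (2 * t)) * poly (P j) t)))
        {0<..} (at_right 0) at_top"
      using t by (intro has_newton_integral_cmult has_newton_integral_sum P) auto
    moreover have "?c * (\<Sum>j\<le>N. real (N choose j) * (sqrt t * exp (- (a * b) / (2 * t)) * poly (P j) t))
        = t powr (- real (n + m) - 3 / 2) * exp (- ((a + b)\<^sup>2 / (4 * t))) * poly R t"
    proof -
      have "?c * (\<Sum>j\<le>N. real (N choose j) * (sqrt t * exp (- (a * b) / (2 * t)) * poly (P j) t))
        = (t powr (- real N - 1) * sqrt t) * (exp (- ((a\<^sup>2 + b\<^sup>2) / (4 * t))) * exp (- (a * b) / (2 * t))) * poly R t"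
        by (simp add: R_def poly_sum sum_distrib_left sum_distrib_right mult_ac)
      also have "t powr (- real N - 1) * sqrt t = t powr (- real (n + m) - 3 / 2)"
        using t by (simp add: N_def flip: powr_half_sqrt powr_add)
      \<comment> \<open>The Bessel integral supplies the cross term that completes the square
        \<open>(a + b)^2\<close>.\<close>
      also have "exp (- ((a\<^sup>2 + b\<^sup>2) / (4 * t))) * exp (- (a * b) / (2 * t)) = exp (- ((a + b)\<^sup>2 / (4 * t)))"
        using t by (simp add: field_simps power2_sum flip: exp_add)
      finally show ?thesis .
    qed
    ultimately have "has_newton_integral
        (\<lambda>r. ?c * (\<Sum>j\<le>N. real (N choose j) * (r powr (real j - real m - 3 / 2) * ?E r)))
        (t powr (- real (n + m) - 3 / 2) * exp (- ((a + b)\<^sup>2 / (4 * t))) * poly R t)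
        {0<..} (at_right 0) at_top"
      by simp
    then have "has_newton_integral
        (\<lambda>y. ?c * (\<Sum>j\<le>N. real (N choose j) * ((y / (t - y)) powr (real j - real m - 3 / 2) * ?E (y / (t - y)))) * (t / (t - y)\<^sup>2))
        (t powr (- real (n + m) - 3 / 2) * exp (- ((a + b)\<^sup>2 / (4 * t))) * poly R t)
        {0<..<t} (at_right 0) (at_left t)"
    proof (rule has_newton_integral_substitution)
      show "((\<lambda>y. y / (t - y)) has_real_derivative t / (t - y)\<^sup>2) (at y)" if "y \<in> {0<..<t}" for y
        using that by (auto intro!: derivative_eq_intros simp: field_simps power2_eq_square)
      show "filterlim (\<lambda>y. y / (t - y)) (at_right 0) (at_right 0)"
        using t by real_asymp
      show "filterlim (\<lambda>y. y / (t - y)) at_top (at_left t)"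
        using t by real_asymp
    qed auto
    then show "has_newton_integral
       (\<lambda>y. ((t - y) powr (- real n - 3 / 2) * exp (- (a\<^sup>2 / (4 * (t - y))))) *
            (y powr (- real m - 3 / 2) * exp (- (b\<^sup>2 / (4 * y)))))
       (t powr (- real (n + m) - 3 / 2) * exp (- ((a + b)\<^sup>2 / (4 * t))) * poly R t)
       {0<..<t} (at_right 0) (at_left t)"
    proof (rule has_newton_integral_cong[rotated])
      fix y assume "y \<in> {0<..<t}"
      define x where "x = t - y"
      define r where "r = y / x"
      have xy: "x > 0" "y > 0" "t = x + y" and r: "r > 0"
        using \<open>y \<in> {0<..<t}\<close> by (auto simp: x_def r_def)
      have "(\<Sum>j\<le>N. real (N choose j) * (r powr (real j - real m - 3 / 2) * ?E r))
          = r powr (- real m - 3 / 2) * (\<Sum>j\<le>N. real (N choose j) * r ^ j) * ?E r"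
      proof -
        have "r powr (real j - real m - 3 / 2) = r powr (- real m - 3 / 2) * r ^ j" for j
          using r by (simp add: algebra_simps flip: powr_realpow powr_add)
        then show ?thesis
          by (simp add: sum_distrib_left sum_distrib_right mult_ac)
      qed
      also have "(\<Sum>j\<le>N. real (N choose j) * r ^ j) = (1 + r) ^ N"
        using binomial_ring[of r 1 N] by (simp add: add.commute)
      also have "1 + r = t / x"
        using xy by (simp add: r_def field_simps)
      also have "(t / x) ^ N = t powr real N * x powr (- real N)"
        using xy t by (simp add: power_divide powr_realpow powr_minus_divide)
      also have "r powr (- real m - 3 / 2) = y powr (- real m - 3 / 2) * x powr (real m + 3 / 2)"
      proof -
        have "(y / x) powr (- k) = y powr (- k) * x powr k" for k
          using xy by (simp add: powr_divide powr_minus_divide)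
        from this[of "real m + 3 / 2"] show ?thesis
          by (simp add: r_def)
      qed
      finally have sum: "(\<Sum>j\<le>N. real (N choose j) * (r powr (real j - real m - 3 / 2) * ?E r))
          = y powr (- real m - 3 / 2) * x powr (real m + 3 / 2)
              * (t powr real N * x powr (- real N)) * ?E r" .
      have ex: "exp (- ((a\<^sup>2 + b\<^sup>2) / (4 * t))) * ?E r = exp (- (a\<^sup>2 / (4 * x))) * exp (- (b\<^sup>2 / (4 * y)))"
      proof -
        have "(a\<^sup>2 + b\<^sup>2) / (4 * t) + (a\<^sup>2 / (4 * t) * r + b\<^sup>2 / (4 * t) / r)
            = a\<^sup>2 / (4 * t) * (1 + r) + b\<^sup>2 / (4 * t) * (1 + 1 / r)"
          by (simp add: algebra_simps add_divide_distrib)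
        also have "\<dots> = a\<^sup>2 / (4 * x) + b\<^sup>2 / (4 * y)"
        proof -
          have "1 + r = t / x" "1 + 1 / r = t / y"
            using xy by (simp_all add: r_def field_simps)
          then show ?thesis
            using t by simp
        qed
        finally show ?thesis
          by (simp flip: exp_add)
      qed
      \<comment> \<open>The powers of \<open>t\<close> from \<open>?c\<close>, the binomial and the
        Jacobian cancel; those of \<open>x\<close> combine to
        \<open>m + 3/2 - N - 2 = -n - 3/2\<close>.\<close>
      have pt: "t powr (- real N - 1) * t powr real N * t = 1"
        using t by (simp add: powr_diff powr_minus)
      have px: "x powr (real m + 3 / 2) * x powr (- real N) / x\<^sup>2 = x powr (- real n - 3 / 2)"
      proof -
        have "x powr (real m + 3 / 2) * x powr (- real N) / x powr 2 = x powr (- real n - 3 / 2)"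
          unfolding powr_add[symmetric] powr_diff[symmetric] by (simp add: N_def algebra_simps)
        then show ?thesis
          using xy by simp
      qed
      have "?c * (\<Sum>j\<le>N. real (N choose j) * (r powr (real j - real m - 3 / 2) * ?E r)) * (t / x\<^sup>2)
        = (t powr (- real N - 1) * t powr real N * t) * (x powr (real m + 3 / 2) * x powr (- real N) / x\<^sup>2)
          * y powr (- real m - 3 / 2) * (exp (- ((a\<^sup>2 + b\<^sup>2) / (4 * t))) * ?E r)"
        unfolding sum by simp
      also have "\<dots> = (x powr (- real n - 3 / 2) * exp (- (a\<^sup>2 / (4 * x)))) *
            (y powr (- real m - 3 / 2) * exp (- (b\<^sup>2 / (4 * y))))"
        unfolding pt px ex by simp
      finally show "?c * (\<Sum>j\<le>N. real (N choose j) * ((y / (t - y)) powr (real j - real m - 3 / 2) * ?E (y / (t - y)))) * (t / (t - y)\<^sup>2)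
        = ((t - y) powr (- real n - 3 / 2) * exp (- (a\<^sup>2 / (4 * (t - y))))) *
            (y powr (- real m - 3 / 2) * exp (- (b\<^sup>2 / (4 * y))))"
        unfolding r_def x_def .
    qed
  qed
qed

section \<open>Total mass of the inverse Gamma densities\<close>

text \<open>Densities with shapes \<open>\<nu> + 1\<close> and \<open>\<nu>\<close> differ by the
  derivative of a function vanishing at both ends, so the mass is the same for all \<open>k\<close>.
  That it equals 1 follows later from the law of \<open>Zn\<close>.\<close>

lemma inv_gamma_density_half_newton_integral:
  obtains V where "\<And>k::nat. has_newton_integral (inv_gamma_density (real k + 1 / 2)) V {0<..} (at_right 0) at_top"
proof -
  obtain \<Psi> where \<Psi>: "\<And>x. (\<Psi> has_real_derivative exp (- x\<^sup>2)) (at x)"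
      "(\<Psi> \<longlongrightarrow> 0) at_bot" "(\<Psi> \<longlongrightarrow> sqrt pi) at_top"
    using gaussian_primitive by metis
  have "has_newton_integral (inv_gamma_density (real k + 1 / 2)) (2 / sqrt pi * \<Psi> 0) {0<..} (at_right 0) at_top" for k
  proof (induction k)
    case 0
    have "has_newton_integral (inv_gamma_density (1 / 2)) (2 / sqrt pi * \<Psi> 0) {0<..} (at_right 0) at_top"
    \<comment> \<open>The increasing map \<open>- 1 / (2 * sqrt t)\<close> carries the half-line
      onto the negative reals, so the limit at infinity is governed by continuity of
      \<open>\<Psi>\<close> at 0.\<close>
    proof (rule has_newton_integralI)
      show "((\<lambda>t. 2 / sqrt pi * \<Psi> (- 1 / (2 * sqrt t))) \<longlongrightarrow> 2 / sqrt pi * 0) (at_right 0)"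
        by (intro tendsto_mult_left filterlim_compose[OF \<Psi>(2)]) real_asymp
      have "isCont \<Psi> 0"
        using \<Psi>(1) by (rule DERIV_isCont)
      then show "((\<lambda>t. 2 / sqrt pi * \<Psi> (- 1 / (2 * sqrt t))) \<longlongrightarrow> 2 / sqrt pi * \<Psi> 0) at_top"
        by (intro tendsto_mult_left isCont_tendsto_compose[of 0 \<Psi>]) (assumption, real_asymp)
      fix t :: real assume "t \<in> {0<..}"
      then have t: "t > 0" by simp
      have "((\<lambda>t. - 1 / (2 * sqrt t)) has_real_derivative 1 / (4 * t * sqrt t)) (at t)"
        using t by (auto intro!: derivative_eq_intros simp: field_simps)
      from DERIV_cmult[OF DERIV_chain2[OF \<Psi>(1) this], of "2 / sqrt pi"]
      have "((\<lambda>t. 2 / sqrt pi * \<Psi> (- 1 / (2 * sqrt t))) has_real_derivative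
          2 / sqrt pi * (exp (- (- 1 / (2 * sqrt t))\<^sup>2) * (1 / (4 * t * sqrt t)))) (at t)" .
      moreover have "t powr (- 1 / 2 - 1) = 1 / (t * sqrt t)"
        using t powr_add[of t 1 "1 / 2"] by (simp add: powr_minus_divide powr_half_sqrt)
      then have "2 / sqrt pi * (exp (- (- 1 / (2 * sqrt t))\<^sup>2) * (1 / (4 * t * sqrt t)))
          = inv_gamma_density (1 / 2) t"
        using t by (simp add: inv_gamma_density_def Gamma_one_half_real power_divide power_mult_distrib)
      ultimately show "((\<lambda>t. 2 / sqrt pi * \<Psi> (- 1 / (2 * sqrt t))) has_real_derivative
          inv_gamma_density (1 / 2) t) (at t)" by simp
    qed simp
    then show ?case by simp
  next
    case (Suc k)
    define \<nu> where "\<nu> = real k + 1 / 2"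
    have \<nu>: "\<nu> > 0" by (simp add: \<nu>_def)
    define c where "c = 1 / (2 powr (2 * \<nu>) * Gamma \<nu>)"
    \<comment> \<open>Differentiating the power gives minus the density of shape
      \<open>\<nu>\<close>; differentiating the exponential gives the one of shape
      \<open>\<nu> + 1\<close>, whose normalizing constant is
      \<open>c / (4 * \<nu>)\<close>.\<close>
    let ?F = "\<lambda>t. c / \<nu> * (t powr (- \<nu>) * exp (- 1 / (4 * t)))"
    have "has_newton_integral (\<lambda>t. inv_gamma_density (\<nu> + 1) t - inv_gamma_density \<nu> t) 0
        {0<..} (at_right 0) at_top"
    proof (rule has_newton_integralI)
      have "((\<lambda>t. t powr (- \<nu>) * exp (- 1 / (4 * t))) \<longlongrightarrow> 0) (at_right 0)"
        by real_asymp
      from tendsto_mult_left[OF this, of "c / \<nu>"] show "(?F \<longlongrightarrow> 0) (at_right 0)" by simp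
      have "((\<lambda>t. t powr (- \<nu>) * exp (- 1 / (4 * t))) \<longlongrightarrow> 0) at_top"
        using \<nu> by real_asymp
      from tendsto_mult_left[OF this, of "c / \<nu>"] show "(?F \<longlongrightarrow> 0) at_top" by simp
      fix t :: real assume "t \<in> {0<..}"
      then have t: "t > 0" by simp
      have exponent: "((\<lambda>t. - 1 / (4 * t)) has_real_derivative 1 / (4 * t\<^sup>2)) (at t)"
        using t by (auto intro!: derivative_eq_intros simp: field_simps power2_eq_square)
      have dens_Suc: "inv_gamma_density (\<nu> + 1) t = c / (4 * \<nu>) * exp (- 1 / (4 * t)) * (t powr (- \<nu>) / t\<^sup>2)"
      proof -
        have "t powr (- (\<nu> + 1) - 1) = t powr (- \<nu>) / t\<^sup>2"
          using t powr_diff[of t "- \<nu>" 2] by (simp add: algebra_simps)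
        moreover have "Gamma (\<nu> + 1) = \<nu> * Gamma \<nu>"
          using \<nu> by (intro Gamma_plus1) (auto elim!: nonpos_Ints_cases)
        moreover have "2 powr (2 * (\<nu> + 1)) = 4 * 2 powr (2 * \<nu>)"
          by (simp add: distrib_left powr_add)
        ultimately show ?thesis
          using t by (simp add: inv_gamma_density_def c_def)
      qed
      have dens: "inv_gamma_density \<nu> t = c * exp (- 1 / (4 * t)) * t powr (- \<nu> - 1)"
        using t by (simp add: inv_gamma_density_def c_def)
      from DERIV_cmult[OF DERIV_mult[OF has_real_derivative_powr[OF t, of "- \<nu>"] DERIV_chain2[OF DERIV_exp exponent]],
          of "c / \<nu>"]
      have "(?F has_real_derivative c / \<nu> * ((- \<nu>) * t powr (- \<nu> - 1) * exp (- 1 / (4 * t))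
          + exp (- 1 / (4 * t)) * (1 / (4 * t\<^sup>2)) * t powr (- \<nu>))) (at t)" .
      moreover have "c / \<nu> * ((- \<nu>) * t powr (- \<nu> - 1) * exp (- 1 / (4 * t))
          + exp (- 1 / (4 * t)) * (1 / (4 * t\<^sup>2)) * t powr (- \<nu>))
          = inv_gamma_density (\<nu> + 1) t - inv_gamma_density \<nu> t"
        unfolding dens dens_Suc using \<nu> t by (simp add: field_simps)
      ultimately show "(?F has_real_derivative inv_gamma_density (\<nu> + 1) t - inv_gamma_density \<nu> t) (at t)"
        by (simp only:)
    qed simp
    from has_newton_integral_add[OF this Suc[folded \<nu>_def]] show ?case
      by (simp add: \<nu>_def add_ac)
  qed
  with that show ?thesis by blast
qed

lemma inv_gamma_density_nonneg: "\<nu> > 0 \<Longrightarrow> 0 \<le> inv_gamma_density \<nu> t"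
  by (auto simp: inv_gamma_density_def Gamma_real_pos less_imp_le)

lemma borel_measurable_inv_gamma_density [measurable]:
  "inv_gamma_density \<nu> \<in> borel_measurable borel"
  unfolding inv_gamma_density_def[abs_def] by measurable

lemma nn_integral_inv_gamma_density_half:
  "(\<integral>\<^sup>+t. ennreal (inv_gamma_density (real k + 1 / 2) t) \<partial>lborel)
    = (\<integral>\<^sup>+t. ennreal (inv_gamma_density (real l + 1 / 2) t) \<partial>lborel)"
proof -
  obtain V where V: "\<And>k::nat. has_newton_integral (inv_gamma_density (real k + 1 / 2)) V
      {0<..} (at_right 0) at_top"
    using inv_gamma_density_half_newton_integral by metis
  have "(\<integral>\<^sup>+t. ennreal (inv_gamma_density (real k + 1 / 2) t) \<partial>lborel) = ennreal V" for k :: nat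
  proof -
    have eint: "einterval (ereal 0) \<infinity> = {0<..}"
      by (auto simp: einterval_def)
    have "(\<integral>\<^sup>+t. ennreal (inv_gamma_density (real k + 1 / 2) t) \<partial>lborel)
        = (\<integral>\<^sup>+t. ennreal (inv_gamma_density (real k + 1 / 2) t) * indicator (einterval (ereal 0) \<infinity>) t \<partial>lborel)"
      by (intro nn_integral_cong) (auto simp: eint inv_gamma_density_def split: split_indicator)
    also have "\<dots> = ennreal V"
    proof (rule nn_integral_has_newton_integral[OF _ _ at_right_ereal at_left_PInf])
      fix t :: real assume "t \<in> einterval (ereal 0) \<infinity>"
      then have t: "t > 0" by (simp add: eint)
      have "isCont (\<lambda>t. 1 / (2 powr (2 * (real k + 1 / 2)) * Gamma (real k + 1 / 2))
          * exp (- 1 / (4 * t)) * t powr (- (real k + 1 / 2) - 1)) t"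
        using t by (intro continuous_intros) auto
      \<comment> \<open>The case distinction in \<open>inv_gamma_density\<close> is invisible near a
        positive point.\<close>
      moreover have "eventually (\<lambda>t. 1 / (2 powr (2 * (real k + 1 / 2)) * Gamma (real k + 1 / 2))
          * exp (- 1 / (4 * t)) * t powr (- (real k + 1 / 2) - 1) = inv_gamma_density (real k + 1 / 2) t) (nhds t)"
        using eventually_nhds_in_open[of "{0<..}" t] t
        by (auto simp: inv_gamma_density_def elim!: eventually_mono)
      ultimately show "isCont (inv_gamma_density (real k + 1 / 2)) t"
        by (rule isCont_cong[THEN iffD1, rotated])
    qed (use V[of k] in \<open>simp_all add: eint inv_gamma_density_nonneg\<close>)
    finally show ?thesis .
  qed
  then show ?thesis by simp
qed

section \<open>Weights, scaling and the final convolution\<close>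

text \<open>The definition indexes weights by the shape parameter itself; the floor recovers
  \<open>k\<close> from \<open>k + 1/2\<close>.\<close>

lemma inv_gamma_convex_combinationI:
  fixes w :: "nat \<Rightarrow> real"
  assumes "\<And>k. k \<le> N \<Longrightarrow> 0 \<le> w k" and "(\<Sum>k\<le>N. w k) = 1"
  shows "inv_gamma_convex_combination (\<lambda>t. \<Sum>k\<le>N. w k * inv_gamma_density (real k + 1 / 2) t)"
proof -
  let ?g = "\<lambda>k. real k + 1 / 2"
  have inj: "inj_on ?g A" for A
    by (auto simp: inj_on_def)
  have inv: "nat \<lfloor>?g k\<rfloor> = k" for k
    by linarith
  show ?thesis
    unfolding inv_gamma_convex_combination_def
    by (intro exI[of _ "?g ` {..N}"] exI[of _ "\<lambda>\<nu>. w (nat \<lfloor>\<nu>\<rfloor>)"])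
       (use assms in \<open>auto simp: sum.reindex[OF inj] inv\<close>)
qed

lemma (in prob_space) nn_integral_distributed_eq_1:
  assumes "distributed M N X f"
  shows "(\<integral>\<^sup>+x. f x \<partial>N) = 1"
proof -
  have "prob_space (density N f)"
    using assms prob_space_distr[of X N]
    by (simp add: distributed_distr_eq_density[symmetric] distributed_measurable)
  then have "emeasure (density N f) (space N) = 1"
    using prob_space.emeasure_space_1 by fastforce
  then show ?thesis
    using assms by (simp add: emeasure_density distributed_borel_measurable cong: nn_integral_cong_simp)
qed

text \<open>Only the sign of \<open>C\<close> is recorded, since the final weights are normalized by
  total mass.\<close>

lemma inv_gamma_density_scaled:
  assumes "a > 0"
  obtains C where "0 \<le> C"
    "\<And>x. x > 0 \<Longrightarrow> inv_gamma_density (real k + 1 / 2) (x / a\<^sup>2) / a\<^sup>2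
       = C * (x powr (- real k - 3 / 2) * exp (- (a\<^sup>2 / (4 * x))))"
proof -
  define c where "c = 1 / (2 powr (2 * (real k + 1 / 2)) * Gamma (real k + 1 / 2))"
  have "0 \<le> c"
    by (simp add: c_def Gamma_real_pos less_imp_le)
  show ?thesis
  proof (rule that[of "c / ((a\<^sup>2) powr (- real k - 3 / 2) * a\<^sup>2)"])
    show "0 \<le> c / ((a\<^sup>2) powr (- real k - 3 / 2) * a\<^sup>2)"
      using \<open>0 \<le> c\<close> by simp
    show "inv_gamma_density (real k + 1 / 2) (x / a\<^sup>2) / a\<^sup>2
       = c / ((a\<^sup>2) powr (- real k - 3 / 2) * a\<^sup>2) * (x powr (- real k - 3 / 2) * exp (- (a\<^sup>2 / (4 * x))))"
      if "x > 0" for x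
      using that \<open>a > 0\<close> by (simp add: inv_gamma_density_def c_def powr_divide algebra_simps)
  qed
qed

theorem mainTheorem6:
  fixes M :: "'a measure" and Zn Zm :: "'a \<Rightarrow> real" and n m :: nat and a :: real
  assumes "prob_space M"
    and "0 \<le> a" and "a \<le> 1"
    and "distributed M lborel Zn (\<lambda>t. ennreal (inv_gamma_density (real n + 1/2) t))"
    and "distributed M lborel Zm (\<lambda>t. ennreal (inv_gamma_density (real m + 1/2) t))"
    and "prob_space.indep_var M borel Zn borel Zm"
  shows "\<exists>f. inv_gamma_convex_combination f \<and>
             distributed M lborel (\<lambda>\<omega>. a\<^sup>2 * Zn \<omega> + (1 - a)\<^sup>2 * Zm \<omega>) (\<lambda>t. ennreal (f t))"
proof -
  interpret prob_space M by fact
  have single: "inv_gamma_convex_combination (inv_gamma_density (real k + 1 / 2))" for k :: nat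
    unfolding inv_gamma_convex_combination_def
    by (intro exI[of _ "{real k + 1 / 2}"] exI[of _ "\<lambda>_. 1"]) auto
  \<comment> \<open>At the endpoints one summand is constantly 0 and has no density, so convolution
    is reserved for the interior.\<close>
  consider "a = 0" | "a = 1" | "0 < a" "0 < 1 - a"
    using assms(2,3) by linarith
  then show ?thesis
  proof cases
    case 1
    then show ?thesis using single assms(5) by auto
  next
    case 2
    then show ?thesis using single assms(4) by auto
  next
    case 3
    define b where "b = 1 - a"
    have pos: "a > 0" "b > 0" "a + b = 1"
      using 3 by (auto simp: b_def)
    let ?d = "\<lambda>c k x. inv_gamma_density (real k + 1 / 2) (x / c\<^sup>2) / c\<^sup>2"
    have scaled: "distributed M lborel (\<lambda>\<omega>. c\<^sup>2 * Z \<omega>) (\<lambda>x. ennreal (?d c k x))"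
      if Z: "distributed M lborel Z (\<lambda>t. ennreal (inv_gamma_density (real k + 1/2) t))" and "c > 0"
      for c k Z
      using distributed_affine[OF Z, of "c\<^sup>2" 0] \<open>c > 0\<close>
      by (simp add: divide_ennreal inv_gamma_density_nonneg)
    have "indep_var borel ((\<lambda>x. a\<^sup>2 * x) \<circ> Zn) borel ((\<lambda>x. b\<^sup>2 * x) \<circ> Zm)"
      using assms(6) by (rule indep_var_compose) auto
    then have indep: "indep_var borel (\<lambda>\<omega>. a\<^sup>2 * Zn \<omega>) borel (\<lambda>\<omega>. b\<^sup>2 * Zm \<omega>)"
      by (simp add: comp_def)
    have conv: "distributed M lborel (\<lambda>\<omega>. a\<^sup>2 * Zn \<omega> + b\<^sup>2 * Zm \<omega>)
        (\<lambda>t. \<integral>\<^sup>+y. ennreal (?d a n (t - y)) * ennreal (?d b m y) \<partial>lborel)"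
      using distributed_convolution[OF indep scaled[OF assms(4) pos(1)] scaled[OF assms(5) pos(2)]] .
    obtain P where P: "degree P \<le> n + m" "\<And>i. 0 \<le> coeff P i"
      "\<And>t. t > 0 \<Longrightarrow> has_newton_integral
       (\<lambda>y. ((t - y) powr (- real n - 3 / 2) * exp (- (a\<^sup>2 / (4 * (t - y))))) *
            (y powr (- real m - 3 / 2) * exp (- (b\<^sup>2 / (4 * y)))))
       (t powr (- real (n + m) - 3 / 2) * exp (- ((a + b)\<^sup>2 / (4 * t))) * poly P t)
       {0<..<t} (at_right 0) (at_left t)"
      using inverse_gamma_kernel_convolution[OF pos(1,2)] by blast
    obtain A where A: "0 \<le> A" "\<And>x. x > 0 \<Longrightarrow> ?d a n x = A * (x powr (- real n - 3 / 2) * exp (- (a\<^sup>2 / (4 * x))))"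
      using inv_gamma_density_scaled[OF pos(1)] by blast
    obtain B where B: "0 \<le> B" "\<And>x. x > 0 \<Longrightarrow> ?d b m x = B * (x powr (- real m - 3 / 2) * exp (- (b\<^sup>2 / (4 * x))))"
      using inv_gamma_density_scaled[OF pos(2)] by blast
    define N where "N = n + m"
    define C where "C = (\<lambda>k::nat. 2 powr (2 * (real k + 1 / 2)) * Gamma (real k + 1 / 2))"
    have C: "C k > 0" for k
      by (simp add: C_def Gamma_real_pos)
    \<comment> \<open>The index is reversed because \<open>t powr (- N - 3/2) * t ^ (N - k)\<close>
      is the power of shape \<open>k + 1/2\<close>; \<open>C k\<close> undoes the normalizing
      constant of that density.\<close>
    define w where "w = (\<lambda>k. A * B * coeff P (N - k) * C k)"
    have w: "0 \<le> w k" for k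
      using A(1) B(1) P(2) C[of k] by (simp add: w_def)
    define f where "f = (\<lambda>t. \<Sum>k\<le>N. w k * inv_gamma_density (real k + 1 / 2) t)"
    have density: "(\<integral>\<^sup>+y. ennreal (?d a n (t - y)) * ennreal (?d b m y) \<partial>lborel) = ennreal (f t)" for t
    proof (cases "t > 0")
      case False
      \<comment> \<open>For \<open>t \<le> 0\<close>, the arguments \<open>t - y\<close> and
        \<open>y\<close> are never both positive.\<close>
      then have "ennreal (?d a n (t - y)) * ennreal (?d b m y) = 0" for y
        using pos by (cases "y > 0") (auto simp: inv_gamma_density_def zero_less_divide_iff)
      then have "(\<integral>\<^sup>+y. ennreal (?d a n (t - y)) * ennreal (?d b m y) \<partial>lborel) = 0"
        by (simp only: nn_integral_const mult_zero_left)
      then show ?thesis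
        using False by (simp add: f_def inv_gamma_density_def)
    next
      case True
      let ?k = "\<lambda>y. ((t - y) powr (- real n - 3 / 2) * exp (- (a\<^sup>2 / (4 * (t - y))))) *
            (y powr (- real m - 3 / 2) * exp (- (b\<^sup>2 / (4 * y))))"
      have eint: "einterval (ereal 0) (ereal t) = {0<..<t}"
        by (auto simp: einterval_def)
      have "(\<integral>\<^sup>+y. ennreal (?d a n (t - y)) * ennreal (?d b m y) \<partial>lborel)
          = (\<integral>\<^sup>+y. ennreal (A * B * ?k y) * indicator (einterval (ereal 0) (ereal t)) y \<partial>lborel)"
      proof (intro nn_integral_cong)
        fix y
        consider "y \<le> 0" | "t \<le> y" | "0 < y" "y < t" by linarith
        then show "ennreal (?d a n (t - y)) * ennreal (?d b m y)
            = ennreal (A * B * ?k y) * indicator (einterval (ereal 0) (ereal t)) y"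
        proof cases
          case 3
          then have "ennreal (?d a n (t - y)) * ennreal (?d b m y)
              = ennreal (?d a n (t - y) * ?d b m y)"
            by (intro ennreal_mult[symmetric] divide_nonneg_nonneg inv_gamma_density_nonneg) auto
          then show ?thesis
            using 3 A(2)[of "t - y"] B(2)[of y] by (simp add: eint mult_ac)
        qed (use pos in \<open>auto simp: eint inv_gamma_density_def divide_le_0_iff zero_less_divide_iff\<close>)
      qed
      also have "\<dots> = ennreal (A * B * (t powr (- real (n + m) - 3 / 2) * exp (- ((a + b)\<^sup>2 / (4 * t))) * poly P t))"
      proof (rule nn_integral_has_newton_integral[OF _ _ at_right_ereal at_left_ereal])
        show "has_newton_integral (\<lambda>y. A * B * ?k y)
          (A * B * (t powr (- real (n + m) - 3 / 2) * exp (- ((a + b)\<^sup>2 / (4 * t))) * poly P t))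
          (einterval (ereal 0) (ereal t)) (at_right 0) (at_left t)"
          unfolding eint by (rule has_newton_integral_cmult[OF P(3)[OF True]])
        show "isCont (\<lambda>y. A * B * ?k y) y" if "y \<in> einterval (ereal 0) (ereal t)" for y
          using that unfolding eint by (intro continuous_intros) auto
      qed (use True A(1) B(1) in auto)
      also have "A * B * (t powr (- real (n + m) - 3 / 2) * exp (- ((a + b)\<^sup>2 / (4 * t))) * poly P t) = f t"
      proof -
        have "poly P t = (\<Sum>i\<le>N. coeff P i * t ^ i)"
          unfolding poly_altdef using P(1)
          by (intro sum.mono_neutral_left) (auto simp: N_def coeff_eq_0)
        also have "\<dots> = (\<Sum>k\<le>N. coeff P (N - k) * t ^ (N - k))"
          by (rule sum.reindex_bij_witness[of _ "\<lambda>k. N - k" "\<lambda>k. N - k"]) auto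
        finally have "A * B * (t powr (- real (n + m) - 3 / 2) * exp (- ((a + b)\<^sup>2 / (4 * t))) * poly P t)
            = (\<Sum>k\<le>N. A * B * coeff P (N - k) * exp (- (1 / (4 * t))) * (t powr (- real N - 3 / 2) * t ^ (N - k)))"
          by (simp add: pos(3) N_def sum_distrib_left mult_ac)
        also have "\<dots> = f t"
          unfolding f_def
        proof (rule sum.cong)
          fix k assume "k \<in> {..N}"
          then have "t powr (- real N - 3 / 2) * t ^ (N - k) = t powr (- (real k + 1 / 2) - 1)"
            using True by (simp add: of_nat_diff flip: powr_realpow powr_add)
          moreover have "inv_gamma_density (real k + 1 / 2) t
              = 1 / C k * exp (- (1 / (4 * t))) * t powr (- (real k + 1 / 2) - 1)"
            using True by (simp add: inv_gamma_density_def C_def)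
          ultimately show "A * B * coeff P (N - k) * exp (- (1 / (4 * t))) * (t powr (- real N - 3 / 2) * t ^ (N - k))
              = w k * inv_gamma_density (real k + 1 / 2) t"
            using C[of k] by (simp add: w_def)
        qed simp
        finally show ?thesis .
      qed
      finally show ?thesis .
    qed
    have dist: "distributed M lborel (\<lambda>\<omega>. a\<^sup>2 * Zn \<omega> + (1 - a)\<^sup>2 * Zm \<omega>) (\<lambda>t. ennreal (f t))"
      by (fact conv[unfolded density, unfolded b_def])
    \<comment> \<open>The law of \<open>Zn\<close> fixes the mass for shape \<open>n + 1/2\<close>,
      and all half-integer shapes share it.\<close>
    have one: "(\<integral>\<^sup>+t. ennreal (inv_gamma_density (real k + 1 / 2) t) \<partial>lborel) = 1" for k
      using nn_integral_distributed_eq_1[OF assms(4)] nn_integral_inv_gamma_density_half[of k n] by simp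
    have "1 = (\<integral>\<^sup>+t. ennreal (f t) \<partial>lborel)"
      using nn_integral_distributed_eq_1[OF dist] by simp
    also have "\<dots> = (\<integral>\<^sup>+t. (\<Sum>k\<le>N. ennreal (w k) * ennreal (inv_gamma_density (real k + 1 / 2) t)) \<partial>lborel)"
      by (simp add: f_def w inv_gamma_density_nonneg flip: ennreal_mult' sum_ennreal)
    also have "\<dots> = ennreal (\<Sum>k\<le>N. w k)"
      by (simp add: nn_integral_sum nn_integral_cmult one w)
    finally have "(\<Sum>k\<le>N. w k) = 1"
      by (metis ennreal_eq_1)
    then have "inv_gamma_convex_combination f"
      unfolding f_def using w by (intro inv_gamma_convex_combinationI)
    with dist show ?thesis by blast
  qed
qed

end
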